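(* Let $p$ be a prime number and $k>1$ an integer. Let $X$ be a finite indecomposable cycle set whose permutation group $\mathcal{G}(X)$ is isomorphic to $(\mathbb{Z}/p^k\mathbb{Z},+)$. Then either $X$ is a multipermutational cycle set of level $1$, or $X$ is (isomorphic to) one of the cycle sets $C(p,k,n,(j_i),(f_i))$ described in the context.
   Context: A cycle set is a non-empty set $X$ with a binary operation $\cdot$ such that every left multiplication $\sigma_x:X\to X,\ y\mapsto x\cdot y$ is bijective and $(x\cdot y)\cdot(x\cdot z)=(y\cdot x)\cdot(y\cdot z)$ for all $x,y,z\in X$. The permutation group $\mathcal{G}(X)$ is the subgroup of $Sym(X)$ generated by $\{\sigma_x\mid x\in X\}$. $X$ is indecomposable if there is no partition $\{Y,Z\}$ of $X$ into non-empty subsets with $\sigma_x(Y)\subseteq Y$ and $\sigma_x(Z)\subseteq Z$ for all $x\in X$ (equivalently, $\mathcal{G}(X)$ is transitive on $X$). For a non-degenerate cycle set (i.e. $x\mapsto x\cdot x$ is bijective; every finite cycle set is non-degenerate) the retraction is the cycle set $\sigma(X):=\{\sigma_x\mid x\in X\}$ with $\sigma_x\cdot\sigma_y:=\sigma_{x\cdot y}$; one puts $\sigma^0(X):=X$, $\sigma^m(X):=\sigma(\sigma^{m-1}(X))$ for $m\ge1$. $X$ is multipermutational of level $m$ if $m$ is the minimal non-negative integer with $|\sigma^m(X)|=1$. Construction of $C(p,k,n,(j_i),(f_i))$. Let $n\ge2$ be an integer and $j_0,\dots,j_n$ non-negative integers with $j_n=0$, $j_0=k$, $j_i<j_{i-1}$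 for $i\in\{1,\dots,n\}$. Let $f_i:\mathbb{Z}/p^{j_i}\mathbb{Z}\to\{0,\dots,p^{j_{i-1}}/p^{j_i}-1\}$, $i\in\{1,\dots,n-1\}$, be functions with $f_i(0)=0$ such that for every $i\in\{1,\dots,n-1\}$ the function $\varphi_i:\{0,\dots,p^{j_i}-1\}\to\{1,\dots,p^{j_{i-1}}-1\}$, $l\mapsto 1+\sum_{m=i}^{n-1}p^{j_m}f_m(l)$ is injective. For $i,j\in\{0,\dots,p^k-1\}$ put $K_{j,i}:=j+1+\sum_{m=2}^{n-1}p^{j_m}f_m(i)$ and $Q_{j,i}:=\sum_{m=1}^{n-1}p^{j_m}f_m(i)+\sum_{m=1}^{n-1}p^{j_m}f_m(K_{j,i})$, and suppose $Q_{i,j}\equiv Q_{j,i}\pmod{p^k}$ for all $i,j\in\{0,\dots,p^k-1\}$. Then $C(p,k,n,(j_i),(f_i))$ is the set $\{0,\dots,p^k-1\}$ with operation $i\cdot j:=\sigma_i(j)$, where $\sigma_i:=\psi^{1+\sum_{m=1}^{n-1}p^{j_m}f_m(i)}$ and $\psi:=(0\;1\;\dots\;p^k-1)$. Here, for an integer $l$, $f_m(l)$ means the value of $f_m$ at the class of $l$ modulo $p^{j_m}$, and empty sums are $0$. *)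

theory Defs
  imports
    "HOL-Algebra.Bij"
    "HOL-Algebra.Elementary_Groups"
    "HOL-Combinatorics.Cycles"
    "HOL-Number_Theory.Cong"
begin

locale cycle_set =
  fixes X :: "'a set" and cop :: "'a \<Rightarrow> 'a \<Rightarrow> 'a"
  assumes nonempty: "X \<noteq> {}"
    and bij: "x \<in> X \<Longrightarrow> bij_betw (cop x) X X"
    and cycloid: "\<lbrakk>x \<in> X; y \<in> X; z \<in> X\<rbrakk> \<Longrightarrow>
           cop (cop x y) (cop x z) = cop (cop y x) (cop y z)"

text \<open>The maps \<open>\<sigma>\<^sub>x\<close> are made extensional, so that they are elements of \<^term>\<open>BijGroup X\<close>
  and so that equality of \<open>\<sigma>\<^sub>x\<close> and \<open>\<sigma>\<^sub>y\<close> only concerns their values on \<open>X\<close>.\<close>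

definition lmult :: "'a set \<Rightarrow> ('a \<Rightarrow> 'a \<Rightarrow> 'a) \<Rightarrow> 'a \<Rightarrow> 'a \<Rightarrow> 'a" where
  "lmult X cop x = (\<lambda>y\<in>X. cop x y)"

definition perm_group :: "'a set \<Rightarrow> ('a \<Rightarrow> 'a \<Rightarrow> 'a) \<Rightarrow> ('a \<Rightarrow> 'a) monoid" where
  "perm_group X cop = subgroup_generated (BijGroup X) (lmult X cop ` X)"

definition indecomposable :: "'a set \<Rightarrow> ('a \<Rightarrow> 'a \<Rightarrow> 'a) \<Rightarrow> bool" where
  "indecomposable X cop \<longleftrightarrow>
     \<not> (\<exists>Y Z. Y \<noteq> {} \<and> Z \<noteq> {} \<and> Y \<union> Z = X \<and> Y \<inter> Z = {} \<and>
          (\<forall>x\<in>X. lmult X cop x ` Y \<subseteq> Y \<and> lmult X cop x ` Z \<subseteq> Z))"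

definition cycle_set_iso ::
    "'a set \<Rightarrow> ('a \<Rightarrow> 'a \<Rightarrow> 'a) \<Rightarrow> 'b set \<Rightarrow> ('b \<Rightarrow> 'b \<Rightarrow> 'b) \<Rightarrow> bool" where
  "cycle_set_iso X cop Y cop' \<longleftrightarrow>
     (\<exists>h. bij_betw h X Y \<and> (\<forall>x\<in>X. \<forall>y\<in>X. h (cop x y) = cop' (h x) (h y)))"

definition retraction :: "'a set \<Rightarrow> ('a \<Rightarrow> 'a \<Rightarrow> 'a) \<Rightarrow> ('a \<Rightarrow> 'a) set" where
  "retraction X cop = lmult X cop ` X"

text \<open>The operation \<open>\<sigma>\<^sub>x \<cdot> \<sigma>\<^sub>y = \<sigma>\<^bsub>x \<cdot> y\<^esub>\<close>, computed on chosen preimages; the lemma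
  \<open>retraction_op_lmult\<close> shows that the choice is immaterial.\<close>

definition retraction_op ::
    "'a set \<Rightarrow> ('a \<Rightarrow> 'a \<Rightarrow> 'a) \<Rightarrow> ('a \<Rightarrow> 'a) \<Rightarrow> ('a \<Rightarrow> 'a) \<Rightarrow> ('a \<Rightarrow> 'a)" where
  "retraction_op X cop f g =
     lmult X cop (cop (inv_into X (lmult X cop) f) (inv_into X (lmult X cop) g))"

lemma (in cycle_set) retraction_op_lmult:
  assumes "x \<in> X" "y \<in> X"
  shows "retraction_op X cop (lmult X cop x) (lmult X cop y) = lmult X cop (cop x y)"
proof -
  have eqD: "cop u w = cop v w" if "lmult X cop u = lmult X cop v" "w \<in> X" for u v w
    using fun_cong[OF that(1), of w] that(2) by (simp add: lmult_def)
  have right: "lmult X cop (cop u v) = lmult X cop (cop u w)"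
    if u: "u \<in> X" and v: "v \<in> X" and w: "w \<in> X" and eq: "lmult X cop v = lmult X cop w" for u v w
  proof -
    have "cop (cop u v) t = cop (cop u w) t" if "t \<in> X" for t
    proof -
      have "t \<in> cop u ` X" using bij[OF u] that unfolding bij_betw_def by blast
      then obtain s where s: "s \<in> X" "t = cop u s" by blast
      have "cop (cop u v) t = cop (cop v u) (cop v s)"
        unfolding s(2) by (rule cycloid[OF u v s(1)])
      also have "\<dots> = cop (cop w u) (cop w s)"
        unfolding eqD[OF eq u] eqD[OF eq s(1)] by (rule refl)
      also have "\<dots> = cop (cop u w) t"
        unfolding s(2) by (rule cycloid[OF u w s(1), symmetric])
      finally show ?thesis .
    qed
    then show ?thesis unfolding lmult_def by (rule restrict_ext)
  qed
  define x' where "x' = inv_into X (lmult X cop) (lmult X cop x)"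
  define y' where "y' = inv_into X (lmult X cop) (lmult X cop y)"
  have x': "x' \<in> X" "lmult X cop x' = lmult X cop x"
    unfolding x'_def using assms(1) by (auto intro: inv_into_into f_inv_into_f)
  have y': "y' \<in> X" "lmult X cop y' = lmult X cop y"
    unfolding y'_def using assms(2) by (auto intro: inv_into_into f_inv_into_f)
  have "lmult X cop (cop x' y') = lmult X cop (cop x y')"
    unfolding eqD[OF x'(2) y'(1)] by (rule refl)
  also have "\<dots> = lmult X cop (cop x y)"
    by (rule right[OF assms(1) y'(1) assms(2) y'(2)])
  finally show ?thesis unfolding retraction_op_def x'_def y'_def .
qed

text \<open>The retraction of a cycle set on \<^typ>\<open>'a\<close> lives on \<^typ>\<open>'a \<Rightarrow> 'a\<close>, so the iterates
  \<open>\<sigma>\<^sup>m(X)\<close> have no common type. As the retraction is never larger than the original set,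
  each iterate is replaced by an isomorphic copy on a subset of \<^typ>\<open>'a\<close>:
  \<open>iterated_retraction X cop m Y cop'\<close> says that \<open>(Y, cop')\<close> is isomorphic to \<open>\<sigma>\<^sup>m(X)\<close>.\<close>

inductive iterated_retraction ::
    "'a set \<Rightarrow> ('a \<Rightarrow> 'a \<Rightarrow> 'a) \<Rightarrow> nat \<Rightarrow> 'a set \<Rightarrow> ('a \<Rightarrow> 'a \<Rightarrow> 'a) \<Rightarrow> bool"
  for X :: "'a set" and cop :: "'a \<Rightarrow> 'a \<Rightarrow> 'a" where
  zero: "iterated_retraction X cop 0 X cop"
| Suc: "\<lbrakk>iterated_retraction X cop m Y cop';
         cycle_set_iso (retraction Y cop') (retraction_op Y cop') Z cop''\<rbrakk>
        \<Longrightarrow> iterated_retraction X cop (Suc m) Z cop''"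

definition retracts_to_point :: "'a set \<Rightarrow> ('a \<Rightarrow> 'a \<Rightarrow> 'a) \<Rightarrow> nat \<Rightarrow> bool" where
  "retracts_to_point X cop m \<longleftrightarrow> (\<exists>Y cop'. iterated_retraction X cop m Y cop' \<and> card Y = 1)"

definition multipermutational_level :: "'a set \<Rightarrow> ('a \<Rightarrow> 'a \<Rightarrow> 'a) \<Rightarrow> nat \<Rightarrow> bool" where
  "multipermutational_level X cop m \<longleftrightarrow>
     retracts_to_point X cop m \<and> (\<forall>l<m. \<not> retracts_to_point X cop l)"

lemma (in cycle_set) multipermutational_level_1_iff:
  "multipermutational_level X cop 1 \<longleftrightarrow> card (retraction X cop) = 1 \<and> card X \<noteq> 1"
proof -
  have it0: "X = Y \<and> cop = cop'" if "iterated_retraction X cop 0 Y cop'" for Y cop'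
    using that by cases simp
  then have 0: "retracts_to_point X cop 0 \<longleftrightarrow> card X = 1"
    unfolding retracts_to_point_def by (metis iterated_retraction.zero)
  have "retracts_to_point X cop 1 \<longleftrightarrow> card (retraction X cop) = 1"
  proof
    assume "retracts_to_point X cop 1"
    then obtain Z cop'' where Z: "iterated_retraction X cop (Suc 0) Z cop''" "card Z = 1"
      by (auto simp: retracts_to_point_def)
    from Z(1) have "cycle_set_iso (retraction X cop) (retraction_op X cop) Z cop''"
      by cases (blast dest: it0)
    with Z(2) show "card (retraction X cop) = 1"
      by (auto simp: cycle_set_iso_def dest: bij_betw_same_card)
  next
    assume "card (retraction X cop) = 1"
    then obtain f where f: "retraction X cop = {f}" by (rule card_1_singletonE)
    obtain x where x: "x \<in> X" using nonempty by blast
    have "cycle_set_iso (retraction X cop) (retraction_op X cop) {x} (\<lambda>_ _. x)"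
      unfolding cycle_set_iso_def f
      by (rule exI[of _ "\<lambda>_. x"]) (auto simp: bij_betw_def)
    then have "iterated_retraction X cop (Suc 0) {x} (\<lambda>_ _. x)"
      by (rule iterated_retraction.Suc[OF iterated_retraction.zero])
    then show "retracts_to_point X cop 1"
      unfolding retracts_to_point_def by (metis One_nat_def card_1_singleton_iff)
  qed
  with 0 show ?thesis by (simp add: multipermutational_level_def)
qed

text \<open>A function on \<open>\<int>/p^(j m)\<int>\<close> is given by its values on the representatives
  \<open>0, \<dots>, p^(j m) - 1\<close>; hence \<open>f m\<close> is always evaluated at a residue modulo \<open>p^(j m)\<close>.
  \<open>digit_sum p j f a b l\<close> is \<open>\<Sum>\<^sub>m p^(j m) f\<^sub>m(l)\<close> with \<open>m\<close> running from \<open>a\<close> to \<open>b\<close>.\<close>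

definition digit_sum ::
    "nat \<Rightarrow> (nat \<Rightarrow> nat) \<Rightarrow> (nat \<Rightarrow> nat \<Rightarrow> nat) \<Rightarrow> nat \<Rightarrow> nat \<Rightarrow> nat \<Rightarrow> nat" where
  "digit_sum p j f a b l = (\<Sum>m = a..b. p ^ j m * f m (l mod p ^ j m))"

definition K_C ::
    "nat \<Rightarrow> nat \<Rightarrow> (nat \<Rightarrow> nat) \<Rightarrow> (nat \<Rightarrow> nat \<Rightarrow> nat) \<Rightarrow> nat \<Rightarrow> nat \<Rightarrow> nat" where
  "K_C p n j f a b = a + 1 + digit_sum p j f 2 (n - 1) b"

definition Q_C ::
    "nat \<Rightarrow> nat \<Rightarrow> (nat \<Rightarrow> nat) \<Rightarrow> (nat \<Rightarrow> nat \<Rightarrow> nat) \<Rightarrow> nat \<Rightarrow> nat \<Rightarrow> nat" where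
  "Q_C p n j f a b =
     digit_sum p j f 1 (n - 1) b + digit_sum p j f 1 (n - 1) (K_C p n j f a b)"

definition C_data ::
    "nat \<Rightarrow> nat \<Rightarrow> nat \<Rightarrow> (nat \<Rightarrow> nat) \<Rightarrow> (nat \<Rightarrow> nat \<Rightarrow> nat) \<Rightarrow> bool" where
  "C_data p k n j f \<longleftrightarrow>
     2 \<le> n \<and> j n = 0 \<and> j 0 = k \<and> (\<forall>i\<in>{1..n}. j i < j (i - 1)) \<and>
     (\<forall>i\<in>{1..n - 1}.
        f i \<in> {0..<p ^ j i} \<rightarrow> {0..p ^ j (i - 1) div p ^ j i - 1} \<and>
        f i 0 = 0 \<and>
        (\<lambda>l. 1 + digit_sum p j f i (n - 1) l) \<in> {0..p ^ j i - 1} \<rightarrow> {1..p ^ j (i - 1) - 1} \<and>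
        inj_on (\<lambda>l. 1 + digit_sum p j f i (n - 1) l) {0..p ^ j i - 1}) \<and>
     (\<forall>a\<in>{0..p ^ k - 1}. \<forall>b\<in>{0..p ^ k - 1}. [Q_C p n j f a b = Q_C p n j f b a] (mod p ^ k))"

definition C_carrier :: "nat \<Rightarrow> nat \<Rightarrow> nat set" where
  "C_carrier p k = {0..p ^ k - 1}"

definition C_op ::
    "nat \<Rightarrow> nat \<Rightarrow> nat \<Rightarrow> (nat \<Rightarrow> nat) \<Rightarrow> (nat \<Rightarrow> nat \<Rightarrow> nat) \<Rightarrow> nat \<Rightarrow> nat \<Rightarrow> nat" where
  "C_op p k n j f a b = (cycle_of_list [0..<p ^ k] ^^ (1 + digit_sum p j f 1 (n - 1) a)) b"

end

theory Submission
  imports Defs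
begin

text \<open>The permutation group is a cyclic \<open>p\<close>-group, and its proper subgroups all lie in the one of index
  \<open>p\<close>; so one of the generating left multiplications already generates the group. Call it
  \<open>\<psi> = \<sigma>\<^bsub>x\<^sub>0\<^esub>\<close>. Indecomposability makes the orbit of \<open>x\<^sub>0\<close> all of \<open>X\<close>, and since the group is
  abelian, \<open>i \<mapsto> \<psi>\<^sup>i(x\<^sub>0)\<close> identifies \<open>\<int>/p\<^sup>k\<int>\<close> with \<open>X\<close>. In this coordinate every left multiplication
  is a translation, \<open>i \<cdot> l = l + s(i)\<close>, with \<open>s(0) = 1\<close>, and the cycle set law becomes the functional
  equation \<open>s(y + s(x)) + s(x) \<equiv> s(x + s(y)) + s(y)\<close>. The locale \<open>translation_labelling\<close> collects
  these properties for an arbitrary modulus \<open>M\<close>.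

  Two consequences of the functional equation carry the rest. First, \<open>s\<close> never takes the value
  \<open>0\<close> modulo \<open>M > 1\<close> (\<open>label_nonzero\<close>). Second, \<open>s(x) \<equiv> s(y)\<close> modulo \<open>M\<close> is a translation invariant
  relation, hence congruence modulo some divisor \<open>d\<close> of \<open>M\<close>; as the value \<open>0\<close> is missed, \<open>s\<close> is not
  injective on residues, so \<open>d < M\<close> (\<open>label_kernel\<close>). Reducing everything modulo \<open>d\<close> again gives such
  a labelling; this is the retraction. Starting from \<open>p\<^sup>k\<close> and iterating therefore produces moduli
  \<open>p^(j 0), p^(j 1), \<dots>\<close> that decrease strictly until they reach \<open>1\<close>, such that the residue of \<open>s(l)\<close>
  modulo \<open>p^(j (m - 1))\<close> depends exactly on the residue of \<open>l\<close> modulo \<open>p^(j m)\<close>.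

  The functions \<open>f m\<close> are the digits of \<open>s(l) - 1\<close> in the mixed radix system with place values
  \<open>p^(j m)\<close>. Their partial sums telescope to the residues of \<open>s(l) - 1\<close>; the range and injectivity
  conditions on the data then restate that \<open>s\<close> misses \<open>0\<close> and has the kernels found above, and the
  symmetry of \<open>Q\<close> is the functional equation (\<open>C_data_of_labelling\<close>). If \<open>s\<close> is constantly \<open>1\<close>, all left
  multiplications coincide and \<open>X\<close> has multipermutational level \<open>1\<close>.\<close>

section \<open>Translation labellings of cyclic groups\<close>

text \<open>The maps \<open>y \<mapsto> y + s x\<close> turn \<open>\<int>/M\<int>\<close> into a cycle set whose left multiplication by \<open>0\<close> is the
  successor. Labels and arguments are natural numbers; only their residues modulo \<open>M\<close> are meaningful,
  except that \<open>label_0\<close> is an equality, so that the same \<open>s\<close> serves for every divisor of \<open>M\<close>.\<close>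

locale translation_labelling =
  fixes M :: nat and s :: "nat \<Rightarrow> nat"
  assumes modulus_pos: "0 < M"
    and label_0: "s 0 = 1"
    and label_period: "[s (x + M) = s x] (mod M)"
    and label_cycloid: "[s (y + s x) + s x = s (x + s y) + s y] (mod M)"
begin

lemma label_period_mult: "[s (x + c * M) = s x] (mod M)"
proof (induction c)
  case (Suc c)
  have "[s ((x + c * M) + M) = s (x + c * M)] (mod M)" by (rule label_period)
  with Suc.IH show ?case by (metis add.assoc add.commute cong_trans mult_Suc)
qed simp

lemma label_cong:
  assumes "[x = y] (mod M)" shows "[s x = s y] (mod M)"
proof -
  have "[s z = s (z mod M)] (mod M)" for z
    using label_period_mult[of "z mod M" "z div M"] by (simp add: mod_div_mult_eq)
  with assms show ?thesis unfolding cong_def by metis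
qed

lemma label_shift_eq: "[s (s x) + s x = s (x + 1) + 1] (mod M)"
  using label_cycloid[of 0 x] by (simp add: label_0)

text \<open>A label \<open>0\<close> at \<open>x\<close> forces a label \<open>0\<close> at \<open>x + 1\<close> by the functional equation for \<open>x\<close> and \<open>0\<close>, hence
  everywhere, contradicting the label \<open>1\<close> at \<open>0\<close>.\<close>

lemma label_nonzero:
  assumes "1 < M" shows "\<not> [s x = 0] (mod M)"
proof
  assume zero: "[s x = 0] (mod M)"
  have step: "[s (z + 1) = 0] (mod M)" if z: "[s z = 0] (mod M)" for z
  proof -
    have "[s (s z) = 1] (mod M)" using label_cong[OF z] by (simp add: label_0)
    from cong_add[OF this z] label_shift_eq[of z] have "[s (z + 1) + 1 = 0 + 1] (mod M)"
      by (metis add.commute cong_sym cong_trans)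
    then show ?thesis by (rule cong_add_rcancel_nat[THEN iffD1])
  qed
  have "[s (x + c) = 0] (mod M)" for c
    using zero step by (induction c) auto
  \<comment> \<open>The shift by \<open>x * (M - 1)\<close> leads from \<open>x\<close> to a multiple of \<open>M\<close>, where the label is \<open>1\<close>.\<close>
  from this[of "x * (M - 1)"] have "[s (0 + x * M) = 0] (mod M)"
    using modulus_pos by (simp add: algebra_simps)
  with label_period_mult[of 0 x] have "[1 = 0] (mod M)"
    unfolding label_0 by (metis cong_sym cong_trans)
  with assms show False by (simp add: cong_def)
qed

text \<open>By \<open>label_shift_eq\<close>, the label of \<open>x + 1\<close> is a function of the label of \<open>x\<close>.\<close>

lemma label_kernel_translate:
  assumes "[s x = s y] (mod M)" shows "[s (x + c) = s (y + c)] (mod M)"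
proof (induction c)
  case (Suc c)
  have "[s (s (x + c)) + s (x + c) = s (s (y + c)) + s (y + c)] (mod M)"
    using Suc label_cong[OF Suc] by (rule cong_add[rotated])
  then have "[s (x + c + 1) + 1 = s (y + c + 1) + 1] (mod M)"
    using label_shift_eq[of "x + c"] label_shift_eq[of "y + c"] by (metis cong_sym cong_trans)
  then have "[s (x + c + 1) = s (y + c + 1)] (mod M)" by (rule cong_add_rcancel_nat[THEN iffD1])
  then show ?case by simp
qed (simp add: assms)

text \<open>Equality of labels is translation invariant, so it means that the difference of the arguments is a
  period of \<open>s\<close>; all periods are multiples of the least one, \<open>d\<close>. If \<open>d\<close> were \<open>M\<close>, the labels of the \<open>M\<close>
  residues would be pairwise distinct and would include \<open>0\<close>. In terms of cycle sets: a nontrivial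
  cycle set of this form is not isomorphic to its retraction.\<close>

lemma label_kernel:
  obtains d where "d dvd M" "1 < M \<Longrightarrow> d < M"
    and "\<And>x y. [s x = s y] (mod M) \<longleftrightarrow> [x = y] (mod d)"
proof -
  define period where "period c \<longleftrightarrow> (\<forall>x. [s (x + c) = s x] (mod M))" for c
  define d where "d = (LEAST c. 0 < c \<and> period c)"
  have M: "0 < M \<and> period M" by (simp add: period_def modulus_pos label_period)
  have d: "0 < d" "period d" using LeastI[of "\<lambda>c. 0 < c \<and> period c", OF M] by (auto simp: d_def)
  have period_mult: "period (d * c)" for c
  proof (induction c)
    case (Suc c)
    with d(2) show ?case unfolding period_def by (metis add.assoc add.commute cong_trans mult_Suc_right)
  qed (simp add: period_def)
  have dvd: "d dvd c" if c: "period c" for c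
  proof -
    have "period (c mod d)" unfolding period_def
    proof
      fix x
      have "[s ((x + c mod d) + d * (c div d)) = s (x + c mod d)] (mod M)"
        using period_mult[of "c div d"] unfolding period_def by blast
      then have "[s (x + c) = s (x + c mod d)] (mod M)" by (simp add: add.assoc)
      moreover have "[s (x + c) = s x] (mod M)" using c by (simp add: period_def)
      ultimately show "[s (x + c mod d) = s x] (mod M)" by (metis cong_sym cong_trans)
    qed
    moreover have "\<not> (0 < c mod d \<and> period (c mod d))"
      using not_less_Least[of "c mod d" "\<lambda>c. 0 < c \<and> period c"] d(1) by (simp add: d_def)
    ultimately show ?thesis by (simp add: dvd_eq_mod_eq_0)
  qed
  have cong_le: "[x = y] (mod d)" if eq: "[s x = s y] (mod M)" and "x \<le> y" for x y
  proof -
    have "period (y - x)" unfolding period_def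
    proof
      fix z
      \<comment> \<open>Translating by \<open>c\<close> moves the pair \<open>x, y\<close> to \<open>z, z + (y - x)\<close>, up to the multiple \<open>x * M\<close> of \<open>M\<close>.\<close>
      define c where "c = z + x * (M - 1)"
      have "x + x * (M - 1) = x * M" using modulus_pos by (cases M) simp_all
      then have "x + c = z + x * M" "y + c = (z + (y - x)) + x * M"
        using \<open>x \<le> y\<close> by (simp_all add: c_def)
      with label_kernel_translate[OF eq, of c] show "[s (z + (y - x)) = s z] (mod M)"
        using label_period_mult by (metis cong_sym cong_trans)
    qed
    from dvd[OF this] \<open>x \<le> y\<close> show ?thesis
      by (metis cong_altdef_nat cong_sym)
  qed
  have iff: "[s x = s y] (mod M) \<longleftrightarrow> [x = y] (mod d)" for x y
  proof
    assume "[s x = s y] (mod M)"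
    then show "[x = y] (mod d)" using cong_le[of x y] cong_le[of y x]
      by (metis cong_sym nat_le_linear)
  next
    have "[s z = s (z mod d)] (mod M)" for z
      using period_mult[of "z div d"] unfolding period_def by (metis mod_mult_div_eq)
    moreover assume "[x = y] (mod d)"
    ultimately show "[s x = s y] (mod M)" unfolding cong_def by metis
  qed
  have "d dvd M" using M dvd by blast
  moreover have "d < M" if "1 < M"
  proof (rule ccontr)
    assume "\<not> d < M"
    with \<open>d dvd M\<close> modulus_pos have "d = M" by (meson dvd_imp_le le_neq_implies_less)
    then have "inj_on (\<lambda>x. s x mod M) {..<M}"
      using iff by (auto simp: inj_on_def cong_def)
    moreover have "(\<lambda>x. s x mod M) ` {..<M} \<subseteq> {1..<M}"
      using label_nonzero[OF that] modulus_pos by (auto simp: cong_def Suc_le_eq)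
    ultimately have "card {..<M} \<le> card {1..<M}" by (rule card_inj_on_le) simp
    with modulus_pos show False by simp
  qed
  ultimately show thesis using iff that by blast
qed

text \<open>This is the passage to the retraction: labels agreeing modulo \<open>M\<close> agree modulo \<open>d\<close>, so the kernel
  of the labels modulo \<open>M\<close> gives the period needed modulo \<open>d\<close>.\<close>

lemma labelling_quotient:
  assumes "d dvd M" and ker: "\<And>x y. [s x = s y] (mod M) \<longleftrightarrow> [x = y] (mod d)"
  shows "translation_labelling d s"
proof
  show "0 < d" using assms(1) modulus_pos by (auto intro: Nat.gr0I)
  show "[s (x + d) = s x] (mod d)" for x
    using ker[of "x + d" x] assms(1) by (auto simp: cong_def intro: cong_dvd_modulus_nat[unfolded cong_def])
  show "[s (y + s x) + s x = s (x + s y) + s y] (mod d)" for x y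
    using label_cycloid assms(1) by (rule cong_dvd_modulus_nat)
qed (rule label_0)

end

text \<open>Iterating \<open>label_kernel\<close> yields the moduli of the successive retractions. The exponents decrease
  strictly as long as they are positive and stay \<open>0\<close> afterwards.\<close>

lemma prime_power_filtration:
  fixes p k :: nat
  assumes "prime p" and lab: "translation_labelling (p ^ k) s"
  obtains j where "j 0 = k" "\<And>i. 0 < j i \<Longrightarrow> j (Suc i) < j i"
    and "\<And>i. translation_labelling (p ^ j i) s"
    and "\<And>i x y. [s x = s y] (mod p ^ j i) \<longleftrightarrow> [x = y] (mod p ^ j (Suc i))"
proof -
  have "1 < p" using \<open>prime p\<close> by (rule prime_gt_1_nat)
  define next_exp where "next_exp a b \<longleftrightarrow> (0 < a \<longrightarrow> b < a) \<and>
    (\<forall>x y. [s x = s y] (mod p ^ a) \<longleftrightarrow> [x = y] (mod p ^ b))" for a b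
  have step: "\<exists>b. translation_labelling (p ^ b) s \<and> next_exp a b"
    if "translation_labelling (p ^ a) s" for a
  proof -
    interpret translation_labelling "p ^ a" s by fact
    obtain d where d: "d dvd p ^ a" "1 < p ^ a \<Longrightarrow> d < p ^ a"
      "\<And>x y. [s x = s y] (mod p ^ a) \<longleftrightarrow> [x = y] (mod d)"
      using label_kernel by blast
    obtain b where b: "d = p ^ b" using d(1) \<open>prime p\<close> by (auto simp: divides_primepow_nat)
    have "translation_labelling (p ^ b) s" using labelling_quotient[OF d(1,3)] b by simp
    moreover have "b < a" if "0 < a"
    proof -
      have "1 < p ^ a" using \<open>1 < p\<close> that by (rule one_less_power)
      with d(2) b \<open>1 < p\<close> show ?thesis by simp
    qed
    ultimately show ?thesis using d(3) b unfolding next_exp_def by blast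
  qed
  have "\<exists>j. \<forall>i. (translation_labelling (p ^ j i) s \<and> (i = 0 \<longrightarrow> j i = k)) \<and> next_exp (j i) (j (Suc i))"
    by (rule dependent_nat_choice) (use lab step in auto)
  then obtain j where "j 0 = k" "\<And>i. translation_labelling (p ^ j i) s"
      "\<And>i. next_exp (j i) (j (Suc i))"
    by blast
  then show thesis using that unfolding next_exp_def by blast
qed

section \<open>Mixed radix digits of the labels\<close>

text \<open>Each residue of \<open>s l - 1\<close> modulo \<open>p^(j (m - 1))\<close> depends only on \<open>l\<close> modulo \<open>p^(j m)\<close>, so the
  digit of place value \<open>p^(j m)\<close> is a well-defined function on \<open>\<int>/p^(j m)\<int>\<close>, as the construction
  demands. Nonconstancy of \<open>s\<close> modulo \<open>p\<^sup>k\<close> is what makes the number \<open>n\<close> of retraction steps at least \<open>2\<close>.\<close>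

lemma C_data_of_labelling:
  fixes p k :: nat
  assumes "prime p" and lab: "translation_labelling (p ^ k) s"
    and nonconst: "\<not> [s x0 = 1] (mod p ^ k)"
  obtains n j f where "C_data p k n j f"
    and "\<forall>l. [1 + digit_sum p j f 1 (n - 1) l = s l] (mod p ^ k)"
proof -
  have p: "1 < p" using \<open>prime p\<close> by (rule prime_gt_1_nat)
  obtain j where j0: "j 0 = k" and dec: "\<And>i. 0 < j i \<Longrightarrow> j (Suc i) < j i"
    and labs: "\<And>i. translation_labelling (p ^ j i) s"
    and ker: "\<And>i x y. [s x = s y] (mod p ^ j i) \<longleftrightarrow> [x = y] (mod p ^ j (Suc i))"
    using prime_power_filtration[OF assms(1,2)] by blast
  have s0: "s 0 = 1" using lab by (rule translation_labelling.label_0)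
  have "\<exists>i. j i = 0"
  proof -
    have "j i = 0 \<or> j i + i \<le> k" for i
    proof (induction i)
      case (Suc i)
      then show ?case
      proof (cases "j i = 0")
        case True
        then have "[0 = 1] (mod p ^ j (Suc i))" using ker[of 0 1 i] by simp
        then have "\<not> 1 < p ^ j (Suc i)" unfolding cong_def by (metis mod_less less_trans zero_less_one zero_neq_one)
        then have "j (Suc i) = 0" using one_less_power[OF p] by blast
        then show ?thesis by simp
      qed (use dec[of i] in auto)
    qed (simp add: j0)
    from this[of "Suc k"] show ?thesis by auto
  qed
  define n where "n = (LEAST i. j i = 0)"
  have jn: "j n = 0" unfolding n_def using \<open>\<exists>i. j i = 0\<close> by (rule LeastI_ex)
  have jpos: "0 < j i" if "i < n" for i using not_less_Least[OF that[unfolded n_def]] by simp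
  have j1: "j 1 \<noteq> 0"
  proof
    assume "j 1 = 0"
    then have "[s x0 = s 0] (mod p ^ k)" using ker[of x0 0 0] by (simp add: j0)
    with nonconst s0 show False by simp
  qed
  have "0 < k"
    using nonconst by (cases k) auto
  have n2: "2 \<le> n" using jn j1 j0 \<open>0 < k\<close> by (cases n rule: nat.exhaust) (auto simp: Suc_le_eq intro!: Nat.gr0I)
  \<comment> \<open>Labels are positive since they are nonzero modulo \<open>p ^ k\<close>, so the truncated subtraction is harmless.\<close>
  define t where "t l = s l - 1" for l
  have s_t: "s l = t l + 1" for l
  proof -
    have "1 < p ^ k" using p \<open>0 < k\<close> by (rule one_less_power)
    from translation_labelling.label_nonzero[OF lab this, of l] show ?thesis
      by (cases "s l") (auto simp: t_def)
  qed
  define f where "f m l = t l mod p ^ j (m - 1) div p ^ j m" for m l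
  have j_le: "j (Suc i) \<le> j i" if "i < n" for i using dec[OF jpos[OF that]] by simp
  have t_cong: "[t x = t y] (mod p ^ j i)" if "[x = y] (mod p ^ j (Suc i))" for i x y
    using that ker[of x y i] cong_add_rcancel_nat unfolding s_t by blast
  have digit: "p ^ j m * f m (l mod p ^ j m) + t l mod p ^ j m = t l mod p ^ j (m - 1)"
    if m: "m \<in> {1..n}" for m l
  proof -
    obtain i where i: "m = Suc i" "i < n" using m by (cases m) auto
    have "t (l mod p ^ j m) mod p ^ j i = t l mod p ^ j i"
      using t_cong[of "l mod p ^ j m" l i] by (simp add: cong_def i)
    then have "f m (l mod p ^ j m) = t l mod p ^ j i div p ^ j m" by (simp add: f_def i)
    moreover have "t l mod p ^ j i mod p ^ j m = t l mod p ^ j m"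
      using j_le[OF i(2)] by (simp add: i le_imp_power_dvd mod_mod_cancel)
    ultimately show ?thesis by (simp add: i) (metis mult_div_mod_eq)
  qed
  \<comment> \<open>Modulo \<open>p ^ j (n - 1)\<close> the labels are constant, because \<open>j n = 0\<close>: there is no further digit.\<close>
  have t_last: "t l mod p ^ j (n - 1) = 0" for l
  proof -
    have "[s l = s 0] (mod p ^ j (n - 1))" using ker[of l 0 "n - 1"] n2 jn by simp
    then have "[t l = 0] (mod p ^ j (n - 1))" unfolding s_t[of l] s0
      by (metis add_0 cong_add_rcancel_nat)
    then show ?thesis by (simp add: cong_def)
  qed
  have digits: "digit_sum p j f a (n - 1) l = t l mod p ^ j (a - 1)" if "1 \<le> a" "a \<le> n" for a l
    using that(2,1)
  proof (induction a rule: inc_induct)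
    case base
    have "{n..n - 1} = {}" using n2 by auto
    then show ?case using t_last by (simp add: digit_sum_def)
  next
    case (step a)
    have "digit_sum p j f a (n - 1) l
        = p ^ j a * f a (l mod p ^ j a) + digit_sum p j f (Suc a) (n - 1) l"
      unfolding digit_sum_def using step.hyps by (subst sum.atLeast_Suc_atMost) auto
    with step show ?case using digit[of a l] by simp
  qed
  \<comment> \<open>A priori \<open>1 + t l mod p ^ j i\<close> could equal \<open>p ^ j i\<close>; this is excluded because \<open>s l\<close> is nonzero modulo \<open>p ^ j i\<close>.\<close>
  have phi: "1 + t l mod p ^ j i < p ^ j i" "[1 + t l mod p ^ j i = s l] (mod p ^ j i)" if "i < n" for i l
  proof -
    show "[1 + t l mod p ^ j i = s l] (mod p ^ j i)" by (simp add: s_t cong_def mod_simps)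
    have "1 < p ^ j i" using p jpos[OF that] by (rule one_less_power)
    moreover from translation_labelling.label_nonzero[OF labs this, of l]
    have "1 + t l mod p ^ j i \<noteq> p ^ j i" by (auto simp: s_t cong_def mod_Suc)
    moreover have "t l mod p ^ j i < p ^ j i" using p by simp
    ultimately show "1 + t l mod p ^ j i < p ^ j i" by linarith
  qed
  have "C_data p k n j f"
    unfolding C_data_def
  proof (intro conjI ballI)
    show "2 \<le> n" "j n = 0" "j 0 = k" by (rule n2 jn j0)+
  next
    fix i assume i: "i \<in> {1..n}"
    then have "i - 1 < n" "Suc (i - 1) = i" by auto
    then show "j i < j (i - 1)" using dec[of "i - 1"] jpos[of "i - 1"] by simp
  next
    fix i assume i: "i \<in> {1..n - 1}"
    then have lt: "i - 1 < n" and Suc: "Suc (i - 1) = i" and le: "1 \<le> i" "i \<le> n" by auto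
    show "f i \<in> {0..<p ^ j i} \<rightarrow> {0..p ^ j (i - 1) div p ^ j i - 1}"
    proof
      fix l
      have "p ^ j (i - 1) = p ^ j i * (p ^ j (i - 1) div p ^ j i)"
        using j_le[OF lt] Suc by (simp add: le_imp_power_dvd)
      moreover have "t l mod p ^ j (i - 1) < p ^ j (i - 1)" using p by simp
      ultimately have "f i l < p ^ j (i - 1) div p ^ j i"
        unfolding f_def by (metis less_mult_imp_div_less mult.commute)
      then show "f i l \<in> {0..p ^ j (i - 1) div p ^ j i - 1}" by simp
    qed
    show "f i 0 = 0" by (simp add: f_def t_def s0)
    show "(\<lambda>l. 1 + digit_sum p j f i (n - 1) l) \<in> {0..p ^ j i - 1} \<rightarrow> {1..p ^ j (i - 1) - 1}"
    proof
      fix l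
      have "1 + digit_sum p j f i (n - 1) l < p ^ j (i - 1)"
        using phi(1)[OF lt, of l] unfolding digits[OF le] .
      then show "1 + digit_sum p j f i (n - 1) l \<in> {1..p ^ j (i - 1) - 1}"
        unfolding atLeastAtMost_iff by linarith
    qed
    show "inj_on (\<lambda>l. 1 + digit_sum p j f i (n - 1) l) {0..p ^ j i - 1}"
    proof (rule inj_onI)
      fix x y assume xy: "x \<in> {0..p ^ j i - 1}" "y \<in> {0..p ^ j i - 1}"
        and "1 + digit_sum p j f i (n - 1) x = 1 + digit_sum p j f i (n - 1) y"
      then have "[s x = s y] (mod p ^ j (i - 1))"
        using phi(2)[OF lt, of x] phi(2)[OF lt, of y] by (metis digits[OF le] cong_sym cong_trans)
      then have "[x = y] (mod p ^ j i)" using ker[of x y "i - 1"] Suc by simp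
      moreover have "x < p ^ j i" "y < p ^ j i"
        using xy zero_less_power[of p "j i"] p unfolding atLeastAtMost_iff by linarith+
      ultimately show "x = y" by (simp add: cong_less_modulus_unique_nat)
    qed
  next
    fix a b
    have Q: "[Q_C p n j f a b + 2 = s b + s (a + s b)] (mod p ^ k)" for a b
    proof -
      have ds: "[1 + digit_sum p j f 1 (n - 1) l = s l] (mod p ^ k)" for l
        using phi(2)[of 0 l] n2 digits[of 1 l] j0 by simp
      \<comment> \<open>\<open>K\<close> omits the digit with index \<open>1\<close>, so it is \<open>a + s b\<close> only modulo \<open>p ^ j 1\<close>; the label of \<open>K\<close>
        modulo \<open>p ^ k\<close> depends on nothing more.\<close>
      have "[1 + digit_sum p j f 2 (n - 1) b = s b] (mod p ^ j 1)"
        using phi(2)[of 1 b] n2 digits[of 2 b] by simp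
      then have "[a + (1 + digit_sum p j f 2 (n - 1) b) = a + s b] (mod p ^ j 1)"
        by (rule cong_add[OF cong_refl])
      then have "[K_C p n j f a b = a + s b] (mod p ^ j (Suc 0))" by (simp add: K_C_def add.assoc)
      then have "[s (K_C p n j f a b) = s (a + s b)] (mod p ^ k)" using ker[of _ _ 0] j0 by simp
      with ds have "[1 + digit_sum p j f 1 (n - 1) (K_C p n j f a b) = s (a + s b)] (mod p ^ k)"
        by (rule cong_trans)
      with ds[of b] have "[(1 + digit_sum p j f 1 (n - 1) b)
          + (1 + digit_sum p j f 1 (n - 1) (K_C p n j f a b)) = s b + s (a + s b)] (mod p ^ k)"
        by (rule cong_add)
      then show ?thesis by (simp add: Q_C_def)
    qed
    have "[Q_C p n j f a b + 2 = Q_C p n j f b a + 2] (mod p ^ k)"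
      using Q[of a b] Q[of b a] translation_labelling.label_cycloid[OF lab, of a b]
      by (metis add.commute cong_sym cong_trans)
    then show "[Q_C p n j f a b = Q_C p n j f b a] (mod p ^ k)"
      by (rule cong_add_rcancel_nat[THEN iffD1])
  qed
  moreover have "[1 + digit_sum p j f 1 (n - 1) l = s l] (mod p ^ k)" for l
    using phi(2)[of 0 l] n2 digits[of 1 l] j0 by simp
  ultimately show thesis using that by blast
qed

section \<open>Coordinates from a cyclic permutation group\<close>

text \<open>If the images of all left multiplications in \<open>\<int>/p\<^sup>k\<int>\<close> were divisible by \<open>p\<close>, so would be the images
  of everything they generate, and \<open>1\<close> would not be attained. A left multiplication whose image is
  prime to \<open>p\<close> generates the group and has order \<open>p\<^sup>k\<close>.\<close>

lemma (in cycle_set) perm_group_generator: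
  fixes p k :: nat
  assumes "prime p" "0 < k" and iso: "perm_group X cop \<cong> integer_mod_group (p ^ k)"
  obtains x0 where "x0 \<in> X" "\<forall>x\<in>X. \<exists>m. \<forall>y\<in>X. cop x y = (cop x0 ^^ m) y"
    and "\<forall>m. (\<forall>y\<in>X. (cop x0 ^^ m) y = y) \<longleftrightarrow> p ^ k dvd m"
proof -
  let ?B = "BijGroup X" and ?G = "perm_group X cop" and ?Z = "integer_mod_group (p ^ k)"
  let ?L = "lmult X cop"
  have p: "1 < p" using \<open>prime p\<close> by (rule prime_gt_1_nat)
  then have N: "0 < p ^ k" "1 < p ^ k" using \<open>0 < k\<close> by (simp, intro one_less_power)
  interpret B: group ?B by (rule group_BijGroup)
  interpret G: group ?G unfolding perm_group_def by (rule B.group_subgroup_generated)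
  have carrier_Z: "carrier ?Z = {0..<int (p ^ k)}" using p by (simp add: carrier_integer_mod_group)
  obtain h where h: "h \<in> iso ?G ?Z" using iso by (auto simp: is_iso_def)
  then have bij_h: "bij_betw h (carrier ?G) (carrier ?Z)" and "h \<in> hom ?G ?Z"
    by (auto simp: iso_def)
  then interpret h: group_hom ?G ?Z h
    by (intro group_hom.intro group_hom_axioms.intro G.is_group group_integer_mod_group)
  have carrier_G: "carrier ?G = generate ?B (carrier ?B \<inter> ?L ` X)"
    by (simp add: perm_group_def carrier_subgroup_generated)
  have G_Bij: "carrier ?G \<subseteq> Bij X"
    using B.carrier_subgroup_generated_subset[of "?L ` X"] by (simp add: perm_group_def BijGroup_def)
  have mult_G: "f \<otimes>\<^bsub>?G\<^esub> g = compose X f g" if "f \<in> carrier ?G" "g \<in> carrier ?G" for f g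
    using that G_Bij by (auto simp: perm_group_def BijGroup_def subgroup_generated_def)
  have one_G: "\<one>\<^bsub>?G\<^esub> = (\<lambda>x\<in>X. x)"
    by (simp add: perm_group_def BijGroup_def subgroup_generated_def)
  have L_Bij: "?L x \<in> Bij X" if "x \<in> X" for x
    using bij[OF that] by (auto simp: lmult_def Bij_def cong: bij_betw_cong)
  have L_G: "?L x \<in> carrier ?G" if "x \<in> X" for x
    unfolding carrier_G using that L_Bij by (auto intro!: generate.incl simp: BijGroup_def)
  have pow_L: "?L x [^]\<^bsub>?G\<^esub> m = restrict (cop x ^^ m) X" if "x \<in> X" for x and m :: nat
  proof (induction m)
    case 0
    show ?case by (auto simp: one_G)
  next
    case (Suc m)
    have "restrict (cop x ^^ m) X \<in> carrier ?G"
      using G.nat_pow_closed[OF L_G[OF that], of m] by (simp only: Suc)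
    then have "?L x [^]\<^bsub>?G\<^esub> Suc m = compose X (restrict (cop x ^^ m) X) (?L x)"
      by (simp only: G.nat_pow_Suc Suc mult_G[OF _ L_G[OF that]])
    also have "\<dots> = restrict (cop x ^^ Suc m) X"
      using bij[OF that]
      by (auto simp: compose_def lmult_def fun_eq_iff restrict_def funpow_swap1 bij_betw_def)
    finally show ?case .
  qed
  have h_pow: "h (?L x [^]\<^bsub>?G\<^esub> m) = int m * h (?L x) mod int (p ^ k)" if "x \<in> X" for x and m :: nat
    using h.hom_nat_pow[OF L_G[OF that], of m] by simp
  have "\<exists>x\<in>X. \<not> int p dvd h (?L x)"
  proof (rule ccontr)
    assume "\<not> ?thesis"
    then have gens: "int p dvd h (?L x)" if "x \<in> X" for x using that by blast
    have p_dvd: "int p dvd a mod int (p ^ k) \<longleftrightarrow> int p dvd a" for a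
      using \<open>0 < k\<close> by (intro dvd_mod_iff) (simp add: dvd_power)
    have all: "int p dvd h g" if "g \<in> generate ?B (carrier ?B \<inter> ?L ` X)" for g
      using that
    proof (induction g rule: generate.induct)
      case one
      have "\<one>\<^bsub>?B\<^esub> = \<one>\<^bsub>?G\<^esub>" by (simp add: perm_group_def)
      then show ?case using h.hom_one by simp
    next
      case (incl g)
      then show ?case using gens by auto
    next
      case (inv g)
      then have g: "g \<in> carrier ?G" "int p dvd h g"
        unfolding carrier_G using gens by (auto intro: generate.incl)
      have "inv\<^bsub>?B\<^esub> g = inv\<^bsub>?G\<^esub> g"
        using g(1) unfolding perm_group_def by (simp add: B.inv_subgroup_generated)
      then show ?case using h.hom_inv[OF g(1)] g h.hom_closed[OF g(1)] by (simp add: p_dvd del: of_nat_power)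
    next
      case (eng g g')
      then have "g \<in> carrier ?G" "g' \<in> carrier ?G" by (simp_all add: carrier_G)
      from h.hom_mult[OF this] have "h (g \<otimes>\<^bsub>?B\<^esub> g') = (h g + h g') mod int (p ^ k)"
        by (simp add: perm_group_def)
      with eng show ?case by (simp add: p_dvd del: of_nat_power)
    qed
    have "1 \<in> carrier ?Z" using p \<open>0 < k\<close> by simp
    then obtain g where "g \<in> carrier ?G" "h g = 1" using bij_h by (metis bij_betw_def imageE)
    with all carrier_G have "int p dvd 1" by metis
    with p show False by simp
  qed
  then obtain x0 where x0: "x0 \<in> X" and ndvd: "\<not> int p dvd h (?L x0)" by blast
  have "prime (int p)" using \<open>prime p\<close> by simp
  then have cop0: "coprime (h (?L x0)) (int (p ^ k))"
    using ndvd by (simp add: coprime_commute prime_imp_coprime)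
  show thesis
  proof (rule that[OF x0]; intro ballI allI)
    fix x assume x: "x \<in> X"
    obtain u where u: "[h (?L x0) * u = 1] (mod int (p ^ k))"
      using cong_solve_coprime_int[OF cop0] by blast
    \<comment> \<open>With \<open>u\<close> inverse to the image of \<open>\<sigma>\<^bsub>x0\<^esub>\<close>, the exponent must be \<open>u\<close> times the image of \<open>\<sigma>\<^sub>x\<close>.\<close>
    define m where "m = nat (u * h (?L x) mod int (p ^ k))"
    have "int m = u * h (?L x) mod int (p ^ k)" using N by (simp add: m_def del: of_nat_power)
    then have "h (?L x0 [^]\<^bsub>?G\<^esub> m) = (h (?L x0) * u) * h (?L x) mod int (p ^ k)"
      by (simp add: h_pow[OF x0] mod_simps ac_simps del: of_nat_power)
    also have "\<dots> = 1 * h (?L x) mod int (p ^ k)"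
      using cong_mult[OF u cong_refl] unfolding cong_def .
    also have "\<dots> = h (?L x)" using h.hom_closed[OF L_G[OF x]] by (simp add: carrier_Z del: of_nat_power)
    finally have "?L x0 [^]\<^bsub>?G\<^esub> m = ?L x"
      using bij_h L_G x x0 by (meson G.nat_pow_closed bij_betw_def inj_onD)
    then have eq: "restrict (cop x0 ^^ m) X = restrict (cop x) X" unfolding pow_L[OF x0] by (simp add: lmult_def)
    have "\<forall>y\<in>X. cop x y = (cop x0 ^^ m) y"
    proof
      fix y assume "y \<in> X"
      with fun_cong[OF eq, of y] show "cop x y = (cop x0 ^^ m) y" by simp
    qed
    then show "\<exists>m. \<forall>y\<in>X. cop x y = (cop x0 ^^ m) y" by blast
  next
    fix m
    have "(\<forall>y\<in>X. (cop x0 ^^ m) y = y) \<longleftrightarrow> ?L x0 [^]\<^bsub>?G\<^esub> m = \<one>\<^bsub>?G\<^esub>"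
      by (auto simp: pow_L[OF x0] one_G fun_eq_iff restrict_def)
    also have "\<dots> \<longleftrightarrow> h (?L x0 [^]\<^bsub>?G\<^esub> m) = h \<one>\<^bsub>?G\<^esub>"
      using inj_on_eq_iff[OF bij_betw_imp_inj_on[OF bij_h] G.nat_pow_closed[OF L_G[OF x0]] G.one_closed]
      by (rule sym)
    also have "\<dots> \<longleftrightarrow> int (p ^ k) dvd int m * h (?L x0)"
      using h.hom_one by (simp add: h_pow[OF x0] dvd_eq_mod_eq_0)
    also have "\<dots> \<longleftrightarrow> int (p ^ k) dvd int m"
      using cop0 by (simp add: coprime_commute coprime_dvd_mult_left_iff del: of_nat_power)
    also have "\<dots> \<longleftrightarrow> p ^ k dvd m" by (rule int_dvd_int_iff)
    finally show "(\<forall>y\<in>X. (cop x0 ^^ m) y = y) \<longleftrightarrow> p ^ k dvd m" .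
  qed
qed

text \<open>The orbit of \<open>x0\<close> and its complement are both stable under the powers of \<open>cop x0\<close>, since these have
  inverses among themselves; indecomposability leaves no room for the complement. A power that fixes
  \<open>x0\<close> commutes with the powers that reach the other points, so it fixes them all.\<close>

lemma (in cycle_set) indecomposable_cyclic_orbit:
  assumes "indecomposable X cop" "0 < N" "x0 \<in> X"
    and pow: "\<forall>x\<in>X. \<exists>m. \<forall>y\<in>X. cop x y = (cop x0 ^^ m) y"
    and id_iff: "\<forall>m. (\<forall>y\<in>X. (cop x0 ^^ m) y = y) \<longleftrightarrow> N dvd m"
  shows "range (\<lambda>i. (cop x0 ^^ i) x0) = X"
    and "(cop x0 ^^ i) x0 = (cop x0 ^^ i') x0 \<longleftrightarrow> [i = i'] (mod N)"
proof -
  define e where "e i = (cop x0 ^^ i) x0" for i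
  have closed: "(cop x0 ^^ m) y \<in> X" if "y \<in> X" for m y
    using that bij[OF \<open>x0 \<in> X\<close>] by (induction m) (auto simp: bij_betw_def)
  have e_add: "(cop x0 ^^ m) (e i) = e (m + i)" for m i by (simp add: e_def funpow_add)
  have e_X: "e i \<in> X" for i unfolding e_def by (rule closed) fact
  have undo: "(cop x0 ^^ (m * (N - 1))) ((cop x0 ^^ m) y) = y" if "y \<in> X" for m y
  proof -
    have "m * (N - 1) + m = N * m" using \<open>0 < N\<close> by (cases N) simp_all
    then have "(cop x0 ^^ (m * (N - 1))) ((cop x0 ^^ m) y) = (cop x0 ^^ (N * m)) y"
      by (metis comp_apply funpow_add)
    also have "\<dots> = y" using id_iff[rule_format, THEN iffD2, OF dvd_triv_left] that by blast
    finally show ?thesis .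
  qed
  have orbit: "range e = X"
  proof (rule ccontr)
    assume neq: "range e \<noteq> X"
    have "lmult X cop x ` range e \<subseteq> range e \<and> lmult X cop x ` (X - range e) \<subseteq> X - range e"
      if x: "x \<in> X" for x
    proof -
      obtain m where m: "\<forall>y\<in>X. cop x y = (cop x0 ^^ m) y" using pow x by blast
      have L: "lmult X cop x y = (cop x0 ^^ m) y" if "y \<in> X" for y
        using m that by (simp add: lmult_def)
      have "lmult X cop x y \<in> X - range e" if y: "y \<in> X - range e" for y
      proof -
        have "(cop x0 ^^ m) y \<noteq> e i" for i
          using undo[of y m] y e_add[of "m * (N - 1)" i] by (metis DiffD1 DiffD2 rangeI)
        then show ?thesis using y closed by (auto simp: L)
      qed
      moreover have "lmult X cop x (e i) \<in> range e" for i using e_X e_add by (simp add: L)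
      ultimately show ?thesis unfolding image_subset_iff ball_simps by (intro conjI ballI allI)
    qed
    moreover have "range e \<union> (X - range e) = X" using e_X by auto
    moreover have "X - range e \<noteq> {}" using e_X neq by auto
    moreover have "range e \<noteq> {}" by simp
    ultimately have "\<exists>Y Z. Y \<noteq> {} \<and> Z \<noteq> {} \<and> Y \<union> Z = X \<and> Y \<inter> Z = {} \<and>
        (\<forall>x\<in>X. lmult X cop x ` Y \<subseteq> Y \<and> lmult X cop x ` Z \<subseteq> Z)"
      by (intro exI[of _ "range e"] exI[of _ "X - range e"] conjI ballI) simp_all
    with assms(1) show False unfolding indecomposable_def by (rule notE)
  qed
  then show "range (\<lambda>i. (cop x0 ^^ i) x0) = X" by (simp add: e_def [abs_def])
  have le: "e i = e i' \<longleftrightarrow> [i = i'] (mod N)" if "i \<le> i'" for i i'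
  proof -
    obtain d where d: "i' = i + d" using \<open>i \<le> i'\<close> by (rule less_eqE)
    have "e i = e i' \<longleftrightarrow> e 0 = e d"
    proof
      assume "e i = e i'"
      then have "(cop x0 ^^ i) (e 0) = (cop x0 ^^ i) (e d)" by (simp add: e_add d)
      then show "e 0 = e d" using undo e_X by metis
    next
      assume "e 0 = e d"
      then show "e i = e i'" by (metis add.right_neutral d e_add)
    qed
    also have "\<dots> \<longleftrightarrow> (\<forall>y\<in>X. (cop x0 ^^ d) y = y)"
    proof
      assume 0: "e 0 = e d"
      have "(cop x0 ^^ d) (e m) = e m" for m
        using 0 e_add[of m 0] e_add[of m d] e_add[of d m] by (simp add: add.commute)
      then show "\<forall>y\<in>X. (cop x0 ^^ d) y = y" using orbit by (metis imageE)
    next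
      assume "\<forall>y\<in>X. (cop x0 ^^ d) y = y"
      then show "e 0 = e d" using e_add[of d 0] e_X[of 0] by simp
    qed
    also have "\<dots> \<longleftrightarrow> [i = i'] (mod N)"
      unfolding id_iff[rule_format] d by (metis cong_0_iff cong_add_lcancel_0_nat cong_sym_eq)
    finally show ?thesis .
  qed
  show "(cop x0 ^^ i) x0 = (cop x0 ^^ i') x0 \<longleftrightarrow> [i = i'] (mod N)"
    using le[of i i'] le[of i' i] unfolding e_def by (metis cong_sym nat_le_linear)
qed

text \<open>In the coordinate \<open>e i = \<sigma>\<^bsub>x0\<^esub>^i(x0)\<close>, the label \<open>s i\<close> is the exponent of \<open>\<sigma>\<^bsub>e i\<^esub>\<close> as a power of
  \<open>\<sigma>\<^bsub>x0\<^esub>\<close>. The functional equation is the cycle set law for \<open>e x\<close>, \<open>e y\<close>, \<open>e 0\<close> read in this coordinate.\<close>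

lemma (in cycle_set) indecomposable_cyclic_labelling:
  assumes "indecomposable X cop" "0 < N" "x0 \<in> X"
    and pow: "\<forall>x\<in>X. \<exists>m. \<forall>y\<in>X. cop x y = (cop x0 ^^ m) y"
    and id_iff: "\<forall>m. (\<forall>y\<in>X. (cop x0 ^^ m) y = y) \<longleftrightarrow> N dvd m"
  obtains e s where "range e = X" "\<forall>i i'. e i = e i' \<longleftrightarrow> [i = i'] (mod N)"
    and "\<forall>i i'. cop (e i) (e i') = e (i' + s i)" "translation_labelling N s"
proof -
  define e where "e i = (cop x0 ^^ i) x0" for i
  have orbit: "range e = X" and e_eq: "e i = e i' \<longleftrightarrow> [i = i'] (mod N)" for i i'
    using indecomposable_cyclic_orbit[OF assms] by (simp_all add: e_def [abs_def])
  \<comment> \<open>The exponent is determined only modulo \<open>N\<close>; at \<open>x0\<close> it is chosen to be \<open>1\<close> exactly.\<close>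
  define s where "s i = (if e i = x0 then 1 else SOME m. \<forall>y\<in>X. cop (e i) y = (cop x0 ^^ m) y)" for i
  have cop_s: "cop (e i) y = (cop x0 ^^ s i) y" if "y \<in> X" for i y
  proof (cases "e i = x0")
    case False
    have "\<exists>m. \<forall>y\<in>X. cop (e i) y = (cop x0 ^^ m) y" using orbit pow by blast
    from someI_ex[OF this] that False show ?thesis by (simp add: s_def)
  qed (simp add: s_def)
  have cop_e: "cop (e i) (e i') = e (i' + s i)" for i i'
  proof -
    have "cop (e i) (e i') = (cop x0 ^^ s i) (e i')" using orbit by (intro cop_s) blast
    also have "\<dots> = e (i' + s i)" by (simp add: e_def add.commute[of i'] funpow_add)
    finally show ?thesis .
  qed
  have "translation_labelling N s"
  proof
    show "s 0 = 1" by (simp add: s_def e_def)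
    fix x y
    have "e (x + N) = e x" by (simp add: e_eq cong_def)
    then show "[s (x + N) = s x] (mod N)" by (simp add: s_def)
    have "e x \<in> X" "e y \<in> X" "e 0 \<in> X" using orbit by auto
    from cycloid[OF this] have "e (s x + s (y + s x)) = e (s y + s (x + s y))"
      by (simp add: cop_e)
    then show "[s (y + s x) + s x = s (x + s y) + s y] (mod N)" by (simp add: e_eq add.commute)
  qed fact
  with orbit e_eq cop_e show thesis using that by blast
qed

section \<open>The classification\<close>

lemma cycle_of_upt_funpow:
  assumes "b < N" shows "(cycle_of_list [0..<N] ^^ m) b = (b + m) mod N"
proof -
  have "map (cycle_of_list [0..<N] ^^ m) [0..<N] ! b = rotate m [0..<N] ! b"
    by (simp add: cyclic_rotation)
  with assms show ?thesis by (simp add: nth_rotate add.commute)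
qed

theorem corollary10:
  fixes p k :: nat and X :: "'a set" and cop :: "'a \<Rightarrow> 'a \<Rightarrow> 'a"
  assumes "prime p" and "k > 1"
    and "cycle_set X cop" and "finite X"
    and "indecomposable X cop"
    and "perm_group X cop \<cong> integer_mod_group (p ^ k)"
  shows "multipermutational_level X cop 1 \<or>
    (\<exists>n j f. C_data p k n j f \<and> cycle_set_iso X cop (C_carrier p k) (C_op p k n j f))"
proof -
  interpret cycle_set X cop by fact
  define N where "N = p ^ k"
  have "1 < N" unfolding N_def using prime_gt_1_nat[OF \<open>prime p\<close>] \<open>k > 1\<close> by (intro one_less_power) simp_all
  have "0 < k" "0 < N" using \<open>k > 1\<close> \<open>1 < N\<close> by simp_all
  obtain x0 where x0: "x0 \<in> X" "\<forall>x\<in>X. \<exists>m. \<forall>y\<in>X. cop x y = (cop x0 ^^ m) y"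
    "\<forall>m. (\<forall>y\<in>X. (cop x0 ^^ m) y = y) \<longleftrightarrow> N dvd m"
    by (rule perm_group_generator[OF \<open>prime p\<close> \<open>0 < k\<close> assms(6), folded N_def])
  obtain e s where orbit: "range e = X"
    and e_eq: "\<forall>i i'. e i = e i' \<longleftrightarrow> [i = i'] (mod N)"
    and cop_e: "\<forall>i i'. cop (e i) (e i') = e (i' + s i)"
    and lab: "translation_labelling N s"
    by (rule indecomposable_cyclic_labelling[OF assms(5) \<open>0 < N\<close> x0])
  note e_eq = e_eq[rule_format] and cop_e = cop_e[rule_format]
  show ?thesis
  proof (cases "\<forall>x. [s x = 1] (mod N)")
    case True
    have "cop (e i) (e i') = e (i' + 1)" for i i'
      using True by (simp add: cop_e e_eq cong_add_lcancel_nat del: One_nat_def)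
    then have "lmult X cop x = lmult X cop (e 0)" if "x \<in> X" for x
      using that orbit unfolding lmult_def by (intro restrict_ext) (metis imageE)
    moreover have "e 0 \<in> X" using orbit by blast
    ultimately have "retraction X cop = {lmult X cop (e 0)}" unfolding retraction_def by blast
    moreover have "card X \<noteq> 1"
    proof
      assume "card X = 1"
      then have "e 0 = e 1" using orbit by (metis card_1_singletonE rangeI singletonD)
      with \<open>1 < N\<close> show False by (simp add: e_eq cong_def)
    qed
    ultimately have "multipermutational_level X cop 1" unfolding multipermutational_level_1_iff by simp
    then show ?thesis ..
  next
    case False
    then obtain x where x: "\<not> [s x = 1] (mod N)" by blast
    obtain n j f where data: "C_data p k n j f"
      and digits: "\<forall>l. [1 + digit_sum p j f 1 (n - 1) l = s l] (mod N)"
      by (rule C_data_of_labelling[OF \<open>prime p\<close> lab[unfolded N_def] x[unfolded N_def], folded N_def])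
    have carrier: "C_carrier p k = {0..<N}" 
      unfolding C_carrier_def N_def[symmetric] using \<open>0 < N\<close> by auto
    have "e ` {0..<N} = X"
    proof -
      have "e i = e (i mod N)" for i by (simp add: e_eq cong_def)
      moreover have "i mod N \<in> {0..<N}" for i using \<open>0 < N\<close> by simp
      ultimately show ?thesis using orbit by blast
    qed
    then have bij_e: "bij_betw e {0..<N} X"
      by (auto simp: bij_betw_def inj_on_def e_eq intro: cong_less_modulus_unique_nat)
    have C_op: "C_op p k n j f a b < N" "e (C_op p k n j f a b) = cop (e a) (e b)" if "b < N" for a b
    proof -
      have eq: "C_op p k n j f a b = (b + (1 + digit_sum p j f 1 (n - 1) a)) mod N"
        unfolding C_op_def N_def[symmetric] by (rule cycle_of_upt_funpow[OF that])
      then show "C_op p k n j f a b < N" using \<open>0 < N\<close> by simp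
      show "e (C_op p k n j f a b) = cop (e a) (e b)"
        unfolding eq cop_e e_eq using cong_add[OF cong_refl digits[rule_format]] by (simp only: cong_mod_left)
    qed
    define h where "h = inv_into {0..<N} e"
    have "bij_betw h X {0..<N}" unfolding h_def using bij_e by (rule bij_betw_inv_into)
    moreover have "h (cop x y) = C_op p k n j f (h x) (h y)" if "x \<in> X" "y \<in> X" for x y
    proof -
      have "h x < N" "h y < N" and xy: "e (h x) = x" "e (h y) = y"
        using that bij_betw_apply[OF \<open>bij_betw h X {0..<N}\<close>] bij_betw_inv_into_right[OF bij_e]
        by (auto simp: h_def)
      with C_op show ?thesis
        using bij_betw_inv_into_left[OF bij_e, of "C_op p k n j f (h x) (h y)"] by (simp add: h_def)
    qed
    ultimately have "cycle_set_iso X cop (C_carrier p k) (C_op p k n j f)"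
      unfolding cycle_set_iso_def carrier by blast
    with data show ?thesis by blast
  qed
qed

end
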